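(* Let $\Gamma=\mathbb{Z}_2*\mathbb{Z}_2*\mathbb{Z}_2*\mathbb{Z}_2$, let $G$ be a $4$-colored graph with vertex set $X$, let $\Phi$ be the induced action of $\Gamma$ on $X$, and let $X_G$ be the type space of $G$ with canonical map $\pi:X\to X_G$. Then $\Phi$ extends to a topological action $\widetilde{\Phi}$ of $\Gamma$ on the metric space $X_G$; that is, there is an action $\widetilde{\Phi}$ of $\Gamma$ on $X_G$ by homeomorphisms such that $\widetilde{\Phi}(\gamma)(\pi(x))=\pi(\Phi(\gamma)(x))$ for all $\gamma\in\Gamma$ and $x\in X$.
   Context: A $4$-colored graph is an infinite connected graph $G$ whose edges are colored by the symbols $A,B,C,D$ so that edges incident to a common vertex have different colors. Let $A,B,C,D$ also denote the order-two generators of the four free factors of $\Gamma$. The induced action $\Phi$ of $\Gamma$ on the vertex set $X$ is defined on a generator $s\in\{A,B,C,D\}$ by $\Phi(s)(x)=y$ if there is an edge $(x,y)$ colored $s$, and $\Phi(s)(x)=x$ if no edge at $x$ is colored $s$. For an integer $r\ge 1$ and $x\in X$, the rooted $r$-ball $B_r(x)$ is the induced (spanned) subgraph of $G$ on the vertices $y$ with $d_G(x,y)\le r$ ($d_G$ the shortest path metric), with root $x$ and the induced edge-coloring. Two rooted $r$-balls are equivalent if there is a graph isomorphism between them preserving edge colors and mapping root to root. $U^r_G$ is the (finite) set of equivalence classes of rooted $r$-balls of $G$, and the $r$-type $\alpha_r(x)\in U^r_G$ of $x$ is the class of $B_r(x)$. For $\alpha\in U^r_G$ and $\beta\in U^{s}_G$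 with $s>r$, write $\alpha\prec\beta$ if the $r$-ball around the root of $\beta$ is of class $\alpha$. The type space $X_G$ is the set of infinite chains $\{\alpha_1\prec\alpha_2\prec\dots\}$ with $\alpha_r\in U^r_G$ for all $r\geq 1$. It is a compact metric space with the metric in which the distance of two distinct chains $\{\alpha_r\}$ and $\{\beta_r\}$ is $2^{-r}$, where $r$ is the smallest integer with $\alpha_r\ne\beta_r$. The map $\pi:X\to X_G$ is $\pi(x)=\{\alpha_1(x)\prec\alpha_2(x)\prec\dots\}$. *)

theory Defs
  imports "HOL-Analysis.Abstract_Metric_Spaces" "HOL-Algebra.Group_Action"
    "HOL-Library.Extended_Nat"
begin

section \<open>The free product of four groups of order two\<close>

datatype color = ColA | ColB | ColC | ColD

text \<open>Each free factor has a single nontrivial element, so the free product consists of the words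
  in the four generators without equal neighbouring letters, multiplied by concatenation
  followed by cancellation.\<close>

definition push :: "color \<Rightarrow> color list \<Rightarrow> color list" where
  "push s w = (case w of [] \<Rightarrow> [s] | t # ts \<Rightarrow> if s = t then ts else s # w)"

definition Gamma :: "color list monoid" where
  "Gamma = \<lparr>carrier = {w. distinct_adj w}, monoid.mult = foldr push, one = []\<rparr>"

definition generator :: "color \<Rightarrow> color list" where
  "generator s = [s]"

lemma push_reduced: "distinct_adj w \<Longrightarrow> distinct_adj (push s w)"
  by (cases w rule: remdups_adj.cases) (auto simp: push_def)

lemma foldr_push_reduced: "distinct_adj w \<Longrightarrow> distinct_adj (foldr push u w)"
  by (induction u) (auto simp: push_reduced)

lemma push_push: "distinct_adj w \<Longrightarrow> push s (push s w) = w"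
  by (cases w rule: remdups_adj.cases) (auto simp: push_def)

lemma push_reduced_Cons: "distinct_adj (s # w) \<Longrightarrow> push s w = s # w"
  by (cases w) (auto simp: push_def)

lemma foldr_in:
  assumes "\<And>s x. x \<in> S \<Longrightarrow> f s x \<in> S" "x \<in> S"
  shows "foldr f u x \<in> S"
  using assms by (induction u) auto

lemma foldr_push:
  assumes "\<And>s x. x \<in> S \<Longrightarrow> f s x \<in> S" "\<And>s x. x \<in> S \<Longrightarrow> f s (f s x) = x" "x \<in> S"
  shows "foldr f (push s v) x = f s (foldr f v x)"
  using assms foldr_in[of S f x] by (cases v) (auto simp: push_def)

lemma foldr_foldr_push:
  assumes "\<And>s x. x \<in> S \<Longrightarrow> f s x \<in> S" "\<And>s x. x \<in> S \<Longrightarrow> f s (f s x) = x" "x \<in> S"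
  shows "foldr f (foldr push u v) x = foldr f u (foldr f v x)"
proof (induction u)
  case (Cons s u)
  then show ?case using foldr_push[of S f x s "foldr push u v"] assms by simp
qed simp

lemma foldr_push_rev: "foldr push (rev w) w = []"
  by (induction w) (auto simp: push_def)

theorem group_Gamma: "group Gamma"
proof (rule groupI)
  fix x y z assume "x \<in> carrier Gamma" "y \<in> carrier Gamma" "z \<in> carrier Gamma"
  then show "x \<otimes>\<^bsub>Gamma\<^esub> y \<otimes>\<^bsub>Gamma\<^esub> z = x \<otimes>\<^bsub>Gamma\<^esub> (y \<otimes>\<^bsub>Gamma\<^esub> z)"
    using foldr_foldr_push[of "{w. distinct_adj w}" push z x y]
    by (simp add: Gamma_def push_reduced push_push)
next
  fix x assume "x \<in> carrier Gamma"
  then show "\<exists>y\<in>carrier Gamma. y \<otimes>\<^bsub>Gamma\<^esub> x = \<one>\<^bsub>Gamma\<^esub>"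
    by (intro bexI[of _ "rev x"]) (auto simp: Gamma_def foldr_push_rev)
qed (auto simp: Gamma_def foldr_push_reduced)

lemma generator_order_two:
  "generator s \<in> carrier Gamma" "generator s \<noteq> \<one>\<^bsub>Gamma\<^esub>"
  "generator s \<otimes>\<^bsub>Gamma\<^esub> generator s = \<one>\<^bsub>Gamma\<^esub>"
  by (auto simp: Gamma_def generator_def push_def)

text \<open>The universal property of the free product: homomorphisms out of it are freely determined
  by four elements of order dividing two.\<close>

theorem Gamma_universal:
  assumes "group H" and f: "\<And>s. f s \<in> carrier H" "\<And>s. f s \<otimes>\<^bsub>H\<^esub> f s = \<one>\<^bsub>H\<^esub>"
  shows "\<exists>h\<in>hom Gamma H. (\<forall>s. h (generator s) = f s) \<and>
    (\<forall>h'\<in>hom Gamma H. (\<forall>s. h' (generator s) = f s) \<longrightarrow> (\<forall>w\<in>carrier Gamma. h' w = h w))"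
proof -
  interpret H: group H by fact
  let ?m = "\<lambda>s x. f s \<otimes>\<^bsub>H\<^esub> x"
  let ?h = "\<lambda>w. foldr ?m w \<one>\<^bsub>H\<^esub>"
  have m: "\<And>s x. x \<in> carrier H \<Longrightarrow> ?m s x \<in> carrier H"
    "\<And>s x. x \<in> carrier H \<Longrightarrow> ?m s (?m s x) = x"
    using f by (simp_all flip: H.m_assoc)
  have cl: "foldr ?m w x \<in> carrier H" if "x \<in> carrier H" for w x
    using that m(1) by (intro foldr_in)
  have app: "foldr ?m u x = ?h u \<otimes>\<^bsub>H\<^esub> x" if "x \<in> carrier H" for u x
    using that f cl by (induction u) (auto simp: H.m_assoc)
  have "?h \<in> hom Gamma H"
  proof (rule homI)
    fix u v assume "u \<in> carrier Gamma" "v \<in> carrier Gamma"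
    show "?h (u \<otimes>\<^bsub>Gamma\<^esub> v) = ?h u \<otimes>\<^bsub>H\<^esub> ?h v"
      using foldr_foldr_push[of "carrier H" ?m "\<one>\<^bsub>H\<^esub>" u v] m app[of "?h v" u] cl
      by (simp add: Gamma_def)
  qed (use cl in auto)
  moreover have "h' w = ?h w"
    if h': "h' \<in> hom Gamma H" "\<forall>s. h' (generator s) = f s" and w: "w \<in> carrier Gamma" for h' w
    using w
  proof (induction w)
    case Nil
    then show ?case
      using group_hom.hom_one[of Gamma H h'] h' group_Gamma H.group_axioms
      by (simp add: group_hom_def group_hom_axioms_def Gamma_def)
  next
    case (Cons s w)
    have w: "w \<in> carrier Gamma" using Cons.prems by (cases w) (auto simp: Gamma_def)
    have "s # w = generator s \<otimes>\<^bsub>Gamma\<^esub> w"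
      using Cons.prems by (simp add: Gamma_def generator_def push_reduced_Cons)
    then have "h' (s # w) = h' (generator s) \<otimes>\<^bsub>H\<^esub> h' w"
      using hom_mult[OF h'(1) generator_order_two(1) w] by simp
    then show ?case using h' Cons.IH[OF w] by simp
  qed
  ultimately show ?thesis
    using f by (intro bexI[of _ ?h]) (auto simp: generator_def)
qed

section \<open>Colored graphs and the induced action\<close>

text \<open>Simple undirected graphs with colored edges; an edge is a two-element set of vertices, and
  the edge set is the domain of the coloring.\<close>

record 'v colored_graph =
  verts :: "'v set"
  coloring :: "'v set \<Rightarrow> color option"

definition adj :: "'v colored_graph \<Rightarrow> ('v \<times> 'v) set" where
  "adj G = {(x, y). {x, y} \<in> dom (coloring G)}"

locale four_colored_graph =
  fixes G :: "'v colored_graph"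
  assumes edge: "e \<in> dom (coloring G) \<Longrightarrow> e \<subseteq> verts G \<and> card e = 2"
    and proper: "e \<in> dom (coloring G) \<Longrightarrow> e' \<in> dom (coloring G) \<Longrightarrow> e \<noteq> e' \<Longrightarrow> e \<inter> e' \<noteq> {} \<Longrightarrow>
      coloring G e \<noteq> coloring G e'"
    and infinite_verts: "infinite (verts G)"
    and connected: "x \<in> verts G \<Longrightarrow> y \<in> verts G \<Longrightarrow> (x, y) \<in> (adj G)\<^sup>*"

definition gen_act :: "'v colored_graph \<Rightarrow> color \<Rightarrow> 'v \<Rightarrow> 'v" where
  "gen_act G s x =
    (if \<exists>y. coloring G {x, y} = Some s then THE y. coloring G {x, y} = Some s else x)"

definition induced_action :: "'v colored_graph \<Rightarrow> color list \<Rightarrow> 'v \<Rightarrow> 'v" where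
  "induced_action G w = (\<lambda>x\<in>verts G. foldr (gen_act G) w x)"

context four_colored_graph
begin

lemma neighbour_unique:
  assumes "coloring G {x, y} = Some s" "coloring G {x, z} = Some s"
  shows "y = z"
  using proper[of "{x, y}" "{x, z}"] assms by (auto simp: doubleton_eq_iff)

lemma gen_act_eq: "coloring G {x, y} = Some s \<Longrightarrow> gen_act G s x = y"
  unfolding gen_act_def using neighbour_unique by (auto intro!: the_equality)

lemma gen_act_in: "x \<in> verts G \<Longrightarrow> gen_act G s x \<in> verts G"
proof (cases "\<exists>y. coloring G {x, y} = Some s")
  case True
  then obtain y where y: "coloring G {x, y} = Some s" by blast
  then show ?thesis using edge[of "{x, y}"] gen_act_eq[OF y] by auto
qed (simp add: gen_act_def)

lemma gen_act_gen_act: "gen_act G s (gen_act G s x) = x"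
proof (cases "\<exists>y. coloring G {x, y} = Some s")
  case True
  then obtain y where y: "coloring G {x, y} = Some s" by blast
  then have "coloring G {y, x} = Some s" by (simp add: insert_commute)
  then show ?thesis using gen_act_eq y by simp
qed (simp add: gen_act_def)

lemma induced_action_generator:
  "x \<in> verts G \<Longrightarrow> induced_action G (generator s) x = gen_act G s x"
  by (simp add: induced_action_def generator_def)

lemma induced_action_mult:
  assumes "x \<in> verts G"
  shows "induced_action G (u \<otimes>\<^bsub>Gamma\<^esub> v) x = induced_action G u (induced_action G v x)"
  using assms foldr_foldr_push[of "verts G" "gen_act G" x u v] gen_act_in gen_act_gen_act
    foldr_in[of "verts G" "gen_act G" x v]
  by (simp add: induced_action_def Gamma_def)

theorem group_action_induced: "group_action Gamma (verts G) (induced_action G)"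
proof -
  have cl: "induced_action G w x \<in> verts G" if "x \<in> verts G" for w x
    using that gen_act_in foldr_in[of "verts G" "gen_act G" x w] by (simp add: induced_action_def)
  have one: "induced_action G \<one>\<^bsub>Gamma\<^esub> x = x" if "x \<in> verts G" for x
    using that by (simp add: induced_action_def Gamma_def)
  have inv: "induced_action G u (induced_action G v x) = x"
    if "x \<in> verts G" "u \<otimes>\<^bsub>Gamma\<^esub> v = \<one>\<^bsub>Gamma\<^esub>" for u v x
    using induced_action_mult[OF that(1), of u v] that one by simp
  have bij: "induced_action G w \<in> Bij (verts G)" if "w \<in> carrier Gamma" for w
  proof -
    have "\<exists>v. v \<otimes>\<^bsub>Gamma\<^esub> w = \<one>\<^bsub>Gamma\<^esub> \<and> w \<otimes>\<^bsub>Gamma\<^esub> v = \<one>\<^bsub>Gamma\<^esub>"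
      using group.l_inv[OF group_Gamma that] group.r_inv[OF group_Gamma that] by blast
    then obtain v where "v \<otimes>\<^bsub>Gamma\<^esub> w = \<one>\<^bsub>Gamma\<^esub>" "w \<otimes>\<^bsub>Gamma\<^esub> v = \<one>\<^bsub>Gamma\<^esub>"
      by blast
    then have "bij_betw (induced_action G w) (verts G) (verts G)"
      using inv cl by (intro bij_betw_byWitness[where f' = "induced_action G v"]) auto
    then show ?thesis by (simp add: Bij_def induced_action_def)
  qed
  have "induced_action G \<in> hom Gamma (BijGroup (verts G))"
  proof (rule homI)
    fix u v assume "u \<in> carrier Gamma" "v \<in> carrier Gamma"
    then show "induced_action G (u \<otimes>\<^bsub>Gamma\<^esub> v) =
        induced_action G u \<otimes>\<^bsub>BijGroup (verts G)\<^esub> induced_action G v"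
      using bij induced_action_mult
      by (auto simp: BijGroup_def compose_def fun_eq_iff) (simp add: induced_action_def)
  qed (use bij in \<open>simp add: BijGroup_def\<close>)
  then show ?thesis
    by (simp add: group_action_def group_hom_def group_hom_axioms_def group_Gamma group_BijGroup)
qed

end

section \<open>Rooted balls and the type space\<close>

definition gdist :: "'v colored_graph \<Rightarrow> 'v \<Rightarrow> 'v \<Rightarrow> enat" where
  "gdist G x y = (INF n\<in>{n. (x, y) \<in> adj G ^^ n}. enat n)"

definition induced_subgraph :: "'v colored_graph \<Rightarrow> 'v set \<Rightarrow> 'v colored_graph" where
  "induced_subgraph G W = \<lparr>verts = W, coloring = coloring G |` Pow W\<rparr>"

type_synonym 'v rooted = "'v colored_graph \<times> 'v"

definition rball :: "nat \<Rightarrow> 'v rooted \<Rightarrow> 'v rooted" where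
  "rball r = (\<lambda>(G, x). (induced_subgraph G {y \<in> verts G. gdist G x y \<le> enat r}, x))"

text \<open>As \<^const>\<open>None\<close> marks a non-edge, the last condition says that edges, non-edges and colors
  are all preserved.\<close>

definition rooted_iso :: "'v rooted \<Rightarrow> 'v rooted \<Rightarrow> bool" where
  "rooted_iso = (\<lambda>(H, x) (K, y). \<exists>f. bij_betw f (verts H) (verts K) \<and> f x = y \<and>
    (\<forall>u\<in>verts H. \<forall>v\<in>verts H. coloring K {f u, f v} = coloring H {u, v}))"

definition rballs :: "'v colored_graph \<Rightarrow> nat \<Rightarrow> 'v rooted set" where
  "rballs G r = {rball r (G, x) | x. x \<in> verts G}"

definition ball_equiv :: "'v colored_graph \<Rightarrow> nat \<Rightarrow> 'v rooted rel" where
  "ball_equiv G r = {(b, b'). b \<in> rballs G r \<and> b' \<in> rballs G r \<and> rooted_iso b b'}"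

definition rtypes :: "'v colored_graph \<Rightarrow> nat \<Rightarrow> 'v rooted set set" where
  "rtypes G r = rballs G r // ball_equiv G r"

definition rtype :: "'v colored_graph \<Rightarrow> nat \<Rightarrow> 'v \<Rightarrow> 'v rooted set" where
  "rtype G r x = ball_equiv G r `` {rball r (G, x)}"

text \<open>For \<open>\<alpha>\<close> a class of \<open>r\<close>-balls and \<open>\<beta>\<close> a class of balls of larger radius: the \<open>r\<close>-ball around
  the root, taken inside a representative of \<open>\<beta>\<close>, lies in \<open>\<alpha>\<close>.\<close>

definition type_prec :: "nat \<Rightarrow> 'v rooted set \<Rightarrow> 'v rooted set \<Rightarrow> bool" where
  "type_prec r \<alpha> \<beta> \<longleftrightarrow> (\<forall>b\<in>\<beta>. rball r b \<in> \<alpha>)"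

text \<open>Chains are indexed by \<open>r \<ge> 1\<close>; extensionality fixes the irrelevant value at \<open>0\<close>.\<close>

definition type_space :: "'v colored_graph \<Rightarrow> (nat \<Rightarrow> 'v rooted set) set" where
  "type_space G =
    {\<alpha> \<in> (\<Pi>\<^sub>E r\<in>{1..}. rtypes G r). \<forall>r\<ge>1. type_prec r (\<alpha> r) (\<alpha> (Suc r))}"

definition type_dist :: "(nat \<Rightarrow> 'a) \<Rightarrow> (nat \<Rightarrow> 'a) \<Rightarrow> real" where
  "type_dist \<alpha> \<beta> = (if \<alpha> = \<beta> then 0 else (1 / 2) ^ (LEAST r. 1 \<le> r \<and> \<alpha> r \<noteq> \<beta> r))"

definition type_map :: "'v colored_graph \<Rightarrow> 'v \<Rightarrow> nat \<Rightarrow> 'v rooted set" where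
  "type_map G x = (\<lambda>r\<in>{1..}. rtype G r x)"

lemma gdist_le_iff: "gdist G x y \<le> enat r \<longleftrightarrow> (\<exists>n\<le>r. (x, y) \<in> adj G ^^ n)"
proof
  let ?S = "enat ` {n. (x, y) \<in> adj G ^^ n}"
  assume le: "gdist G x y \<le> enat r"
  then have "?S \<noteq> {}" by (auto simp: gdist_def Inf_enat_def split: if_splits)
  then have "Inf ?S \<in> ?S" unfolding Inf_enat_def by (auto intro: LeastI)
  then show "\<exists>n\<le>r. (x, y) \<in> adj G ^^ n" using le by (auto simp: gdist_def)
next
  assume "\<exists>n\<le>r. (x, y) \<in> adj G ^^ n"
  then show "gdist G x y \<le> enat r"
    unfolding gdist_def by (meson INF_lower2 enat_ord_simps(1) mem_Collect_eq)
qed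

lemma adj_induced: "adj (induced_subgraph G W) = adj G \<inter> W \<times> W"
  by (auto simp: adj_def induced_subgraph_def restrict_map_def split: if_splits)

lemma adj_rball: "adj (fst (rball r b)) \<subseteq> verts (fst (rball r b)) \<times> verts (fst (rball r b))"
proof -
  have "verts (induced_subgraph G W) = W" for G :: "'a colored_graph" and W
    by (simp add: induced_subgraph_def)
  then show ?thesis by (cases b) (auto simp: rball_def adj_induced)
qed

lemma rooted_iso_refl: "rooted_iso b b"
  by (cases b) (auto simp: rooted_iso_def intro!: exI[of _ "\<lambda>x. x"] simp: bij_betw_def)

lemma rooted_iso_sym:
  assumes "rooted_iso (H, x) (K, y)" "x \<in> verts H"
  shows "rooted_iso (K, y) (H, x)"
proof -
  obtain f where f: "bij_betw f (verts H) (verts K)" "f x = y"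
    "\<And>u v. u \<in> verts H \<Longrightarrow> v \<in> verts H \<Longrightarrow> coloring K {f u, f v} = coloring H {u, v}"
    using assms by (auto simp: rooted_iso_def)
  let ?g = "inv_into (verts H) f"
  have "bij_betw ?g (verts K) (verts H)" using f(1) by (rule bij_betw_inv_into)
  moreover have "?g y = x" using f assms(2) by (auto simp: bij_betw_def)
  moreover have "coloring H {?g u, ?g v} = coloring K {u, v}"
    if "u \<in> verts K" "v \<in> verts K" for u v
    using f(3)[of "?g u" "?g v"] that f(1)
    by (simp add: bij_betw_inv_into_right inv_into_into bij_betw_imp_surj_on)
  ultimately show ?thesis by (auto simp: rooted_iso_def)
qed

lemma rooted_iso_trans:
  assumes "rooted_iso a b" "rooted_iso b c"
  shows "rooted_iso a c"
proof -
  obtain H x K y L z where abc: "a = (H, x)" "b = (K, y)" "c = (L, z)"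
    by (cases a, cases b, cases c)
  obtain f g where "bij_betw f (verts H) (verts K)" "f x = y"
    "\<forall>u\<in>verts H. \<forall>v\<in>verts H. coloring K {f u, f v} = coloring H {u, v}"
    "bij_betw g (verts K) (verts L)" "g y = z"
    "\<forall>u\<in>verts K. \<forall>v\<in>verts K. coloring L {g u, g v} = coloring K {u, v}"
    using assms by (auto simp: rooted_iso_def abc)
  then show ?thesis
    unfolding rooted_iso_def abc prod.case
    by (intro exI[of _ "g \<circ> f"]) (auto intro: bij_betw_trans dest: bij_betwE)
qed

lemma root_in_rball: "x \<in> verts G \<Longrightarrow> x \<in> verts (fst (rball r (G, x)))"
  by (auto simp: rball_def induced_subgraph_def gdist_le_iff intro!: exI[of _ 0])

theorem equiv_ball_equiv: "equiv (rballs G r) (ball_equiv G r)"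
proof (rule equivI)
  show "sym (ball_equiv G r)"
  proof (rule symI)
    fix b c assume *: "(b, c) \<in> ball_equiv G r"
    then obtain x where "x \<in> verts G" "b = rball r (G, x)"
      by (auto simp: ball_equiv_def rballs_def)
    then have "snd b \<in> verts (fst b)" using root_in_rball by (auto simp: rball_def)
    then show "(c, b) \<in> ball_equiv G r"
      using * rooted_iso_sym[of "fst b" "snd b" "fst c" "snd c"] by (auto simp: ball_equiv_def)
  qed
  show "trans (ball_equiv G r)"
    by (rule transI) (auto simp: ball_equiv_def intro: rooted_iso_trans)
qed (auto simp: refl_on_def ball_equiv_def rooted_iso_refl)

lemma relpow_iso:
  assumes "\<And>u v. u \<in> verts H \<Longrightarrow> v \<in> verts H \<Longrightarrow> coloring K {f u, f v} = coloring H {u, v}"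
    and "adj H \<subseteq> verts H \<times> verts H" "(x, y) \<in> adj H ^^ n"
  shows "(f x, f y) \<in> adj K ^^ n"
  using assms(3)
proof (induction n arbitrary: y)
  case (Suc n)
  then obtain z where z: "(x, z) \<in> adj H ^^ n" "(z, y) \<in> adj H" by auto
  then have "z \<in> verts H" "y \<in> verts H" using assms(2) by auto
  then have "(f z, f y) \<in> adj K" using assms(1)[of z y] z(2) by (simp add: adj_def dom_def)
  then show ?case using Suc.IH[OF z(1)] by auto
qed simp

lemma rooted_iso_rball:
  assumes iso: "rooted_iso (H, x) (K, y)" and x: "x \<in> verts H"
    and H: "adj H \<subseteq> verts H \<times> verts H" and K: "adj K \<subseteq> verts K \<times> verts K"
  shows "rooted_iso (rball r (H, x)) (rball r (K, y))"
proof -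
  obtain f where f: "bij_betw f (verts H) (verts K)" "f x = y"
    "\<And>u v. u \<in> verts H \<Longrightarrow> v \<in> verts H \<Longrightarrow> coloring K {f u, f v} = coloring H {u, v}"
    using iso by (auto simp: rooted_iso_def)
  let ?g = "inv_into (verts H) f"
  have g: "coloring H {?g u, ?g v} = coloring K {u, v}"
    if "u \<in> verts K" "v \<in> verts K" for u v
    using f(3)[of "?g u" "?g v"] that f(1)
    by (simp add: bij_betw_inv_into_right inv_into_into bij_betw_imp_surj_on)
  have gf: "?g (f u) = u" if "u \<in> verts H" for u
    using f(1) that by (simp add: bij_betw_inv_into_left)
  let ?V = "{v \<in> verts H. gdist H x v \<le> enat r}"
  let ?W = "{v \<in> verts K. gdist K y v \<le> enat r}"
  have d: "gdist K y (f v) \<le> enat r \<longleftrightarrow> gdist H x v \<le> enat r" if v: "v \<in> verts H" for v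
  proof -
    have "(y, f v) \<in> adj K ^^ n \<longleftrightarrow> (x, v) \<in> adj H ^^ n" for n
      using relpow_iso[of H K f x v n] relpow_iso[of K H ?g y "f v" n] f g H K gf v x by auto
    then show ?thesis by (simp add: gdist_le_iff)
  qed
  have "f ` ?V = ?W"
  proof
    show "f ` ?V \<subseteq> ?W" using d f(1) by (auto dest: bij_betwE)
    show "?W \<subseteq> f ` ?V"
    proof
      fix w assume w: "w \<in> ?W"
      then obtain v where "v \<in> verts H" "w = f v" using f(1) by (auto simp: bij_betw_def)
      then show "w \<in> f ` ?V" using w d by auto
    qed
  qed
  then have "bij_betw f ?V ?W" using f(1) by (auto simp: bij_betw_def intro: inj_on_subset)
  moreover have "coloring (induced_subgraph K ?W) {f u, f v} =
      coloring (induced_subgraph H ?V) {u, v}" if "u \<in> ?V" "v \<in> ?V" for u v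
  proof -
    have "f u \<in> ?W" "f v \<in> ?W" using \<open>f ` ?V = ?W\<close> that by blast+
    then have "coloring (induced_subgraph K ?W) {f u, f v} = coloring K {f u, f v}"
      by (simp add: induced_subgraph_def)
    moreover have "coloring (induced_subgraph H ?V) {u, v} = coloring H {u, v}"
      using that by (simp add: induced_subgraph_def)
    ultimately show ?thesis using f(3) that by simp
  qed
  ultimately show ?thesis
    unfolding rooted_iso_def rball_def using f(2)
    by (auto simp: induced_subgraph_def intro!: exI[of _ f])
qed

lemma (in four_colored_graph) rball_rball:
  assumes x: "x \<in> verts G" and "r \<le> s"
  shows "rball r (rball s (G, x)) = rball r (G, x)"
proof -
  let ?W = "{y \<in> verts G. gdist G x y \<le> enat s}"
  have *: "(x, y) \<in> adj (induced_subgraph G ?W) ^^ n \<longleftrightarrow> (x, y) \<in> adj G ^^ n" if "n \<le> s" for n y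
    using that
  proof (induction n arbitrary: y)
    case (Suc n)
    have "(x, y) \<in> adj (induced_subgraph G ?W) ^^ Suc n"
      if xz: "(x, z) \<in> adj G ^^ n" and zy: "(z, y) \<in> adj G" for z
    proof -
      have "z \<in> verts G" "y \<in> verts G" using zy edge by (fastforce simp: adj_def)+
      moreover have "(x, y) \<in> adj G ^^ Suc n" using xz zy by auto
      ultimately have "(z, y) \<in> adj (induced_subgraph G ?W)"
        using xz zy Suc.prems by (auto simp: adj_induced gdist_le_iff simp del: relpow.simps
          intro: exI[of _ n] exI[of _ "Suc n"])
      then show ?thesis using Suc xz by auto
    qed
    moreover have "(x, y) \<in> adj G ^^ Suc n" if "(x, y) \<in> adj (induced_subgraph G ?W) ^^ Suc n"
      using that Suc by (auto simp: adj_induced)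
    ultimately show ?case by (auto elim: relpow_Suc_E)
  qed simp
  have V: "{y \<in> ?W. gdist (induced_subgraph G ?W) x y \<le> enat r} = {y \<in> verts G. gdist G x y \<le> enat r}"
    using * assms(2) by (auto simp: gdist_le_iff) (meson order_trans)+
  then show ?thesis
    unfolding rball_def by (auto simp: induced_subgraph_def restrict_map_def fun_eq_iff)
qed

theorem (in four_colored_graph) type_map_in_type_space:
  assumes x: "x \<in> verts G"
  shows "type_map G x \<in> type_space G"
proof -
  have "rtype G r x \<in> rtypes G r" for r
    using x by (auto simp: rtype_def rtypes_def rballs_def intro!: quotientI)
  moreover have "type_prec r (rtype G r x) (rtype G (Suc r) x)" for r
    unfolding type_prec_def
  proof
    fix b assume "b \<in> rtype G (Suc r) x"
    then obtain y where y: "y \<in> verts G" "b = rball (Suc r) (G, y)"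
      and iso: "rooted_iso (rball (Suc r) (G, x)) b"
      by (auto simp: rtype_def ball_equiv_def rballs_def)
    have bx: "(fst (rball (Suc r) (G, x)), x) = rball (Suc r) (G, x)" by (simp add: rball_def)
    have "rooted_iso (rball r (rball (Suc r) (G, x))) (rball r b)"
      using rooted_iso_rball[of "fst (rball (Suc r) (G, x))" x "fst b" "snd b" r] iso
        root_in_rball[OF x, of "Suc r"] y(2)
        adj_rball[of "Suc r" "(G, x)"] adj_rball[of "Suc r" "(G, y)"]
      unfolding bx by simp
    then show "rball r b \<in> rtype G r x"
      using x y by (auto simp: rball_rball rtype_def ball_equiv_def rballs_def)
  qed
  ultimately show ?thesis by (auto simp: type_space_def type_map_def)
qed

theorem Metric_space_type_space: "Metric_space (type_space G) type_dist"
proof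
  fix \<alpha> \<beta> \<gamma> :: "nat \<Rightarrow> 'a rooted set"
  show "0 \<le> type_dist \<alpha> \<beta>" by (simp add: type_dist_def)
  show "type_dist \<alpha> \<beta> = type_dist \<beta> \<alpha>" by (simp add: type_dist_def eq_commute)
  show "(type_dist \<alpha> \<beta> = 0) = (\<alpha> = \<beta>)" by (simp add: type_dist_def)
  assume *: "\<alpha> \<in> type_space G" "\<beta> \<in> type_space G" "\<gamma> \<in> type_space G"
  show "type_dist \<alpha> \<gamma> \<le> type_dist \<alpha> \<beta> + type_dist \<beta> \<gamma>"
  proof (cases "\<alpha> = \<beta> \<or> \<beta> = \<gamma> \<or> \<alpha> = \<gamma>")
    case False
    define r where "r = (LEAST r. 1 \<le> r \<and> \<alpha> r \<noteq> \<gamma> r)"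
    have "\<exists>r\<ge>1. \<alpha> r \<noteq> \<gamma> r"
      using * False PiE_ext[of \<alpha> "{1..}" "rtypes G" \<gamma>] by (auto simp: type_space_def)
    then have r: "1 \<le> r" "\<alpha> r \<noteq> \<gamma> r"
      unfolding r_def by (metis (mono_tags, lifting) LeastI)+
    have le: "(1/2) ^ r \<le> type_dist a b" if "a r \<noteq> b r" for a b :: "nat \<Rightarrow> 'a rooted set"
      using that r(1) Least_le[of "\<lambda>r. 1 \<le> r \<and> a r \<noteq> b r" r]
      by (auto simp: type_dist_def intro!: power_decreasing)
    have nn: "0 \<le> type_dist a b" for a b :: "nat \<Rightarrow> 'a rooted set" by (simp add: type_dist_def)
    have "type_dist \<alpha> \<gamma> = (1/2) ^ r" using False by (simp add: type_dist_def r_def)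
    moreover have "\<alpha> r \<noteq> \<beta> r \<or> \<beta> r \<noteq> \<gamma> r" using r by metis
    ultimately show ?thesis
      using le[of \<alpha> \<beta>] le[of \<beta> \<gamma>] nn[of \<alpha> \<beta>] nn[of \<beta> \<gamma>] by linarith
  qed (auto simp: type_dist_def)
qed

definition type_topology :: "'v colored_graph \<Rightarrow> (nat \<Rightarrow> 'v rooted set) topology" where
  "type_topology G = Metric_space.mtopology (type_space G) type_dist"

end

theory Submission imports Defs begin

text \<open>The type of radius \<open>r + 1\<close> of a vertex \<open>x\<close> determines the type of radius \<open>r\<close> of its image
  under a generator \<open>s\<close>: the \<open>r\<close>-ball around that image lies inside the \<open>(r + 1)\<close>-ball around \<open>x\<close>,
  and an isomorphism of rooted colored balls carries the \<open>s\<close>-edge at one root to the \<open>s\<close>-edge at the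
  other (\<open>rtype_gen_act\<close>). Letter by letter, applying a word \<open>w\<close> costs at most its length in radius
  (\<open>rtype_induced_action\<close>). For the distance of the type space this means that \<open>w\<close> acts on the
  points \<open>\<pi>(x)\<close> with Lipschitz constant \<open>2\<close> to the power of the length of \<open>w\<close>.

  Every member of a chain in the type space is realised by a vertex, and compatibility of the chain
  makes this vertex realise all earlier members as well. So each chain is a limit of points
  \<open>\<pi>(x)\<close> (\<open>ex_approximates\<close>), and the action extends to chains by letting \<open>w\<close> act on approximating
  vertices (\<open>type_action_approximates\<close>). The identities of an action hold for vertices and pass to
  chains through common approximations. The Lipschitz estimate survives the extension, so every
  group element acts continuously, and its inverse in the group provides a continuous inverse
  map.\<close>

section \<open>Group actions and word length\<close>

text \<open>The laws of an action make the inverse group element an inverse map, so bijectivity follows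
  from closure under the action.\<close>

lemma group_actionI:
  assumes "group H"
    and ext: "\<And>g. g \<in> carrier H \<Longrightarrow> \<phi> g \<in> extensional E"
    and cl: "\<And>g x. g \<in> carrier H \<Longrightarrow> x \<in> E \<Longrightarrow> \<phi> g x \<in> E"
    and one: "\<And>x. x \<in> E \<Longrightarrow> \<phi> \<one>\<^bsub>H\<^esub> x = x"
    and mult: "\<And>g h x. g \<in> carrier H \<Longrightarrow> h \<in> carrier H \<Longrightarrow> x \<in> E \<Longrightarrow>
      \<phi> (g \<otimes>\<^bsub>H\<^esub> h) x = \<phi> g (\<phi> h x)"
  shows "group_action H E \<phi>"
proof -
  interpret H: group H by fact
  have bij: "\<phi> g \<in> Bij E" if g: "g \<in> carrier H" for g
  proof -
    have "bij_betw (\<phi> g) E E"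
      using g cl one by (intro bij_betw_byWitness[where f' = "\<phi> (inv\<^bsub>H\<^esub> g)"])
        (auto simp flip: mult)
    then show ?thesis using ext[OF g] by (simp add: Bij_def)
  qed
  have "\<phi> \<in> hom H (BijGroup E)"
  proof (rule homI)
    fix g h assume gh: "g \<in> carrier H" "h \<in> carrier H"
    then have "\<phi> (g \<otimes>\<^bsub>H\<^esub> h) = compose E (\<phi> g) (\<phi> h)"
      using mult ext by (intro extensionalityI[of _ E]) (auto simp: compose_def)
    then show "\<phi> (g \<otimes>\<^bsub>H\<^esub> h) = \<phi> g \<otimes>\<^bsub>BijGroup E\<^esub> \<phi> h"
      using gh bij by (simp add: BijGroup_def)
  qed (use bij in \<open>simp add: BijGroup_def\<close>)
  then show ?thesis
    by (simp add: group_action_def group_hom_def group_hom_axioms_def H.group_axioms group_BijGroup)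
qed

text \<open>Multiplication concatenates words and then only cancels letters.\<close>

lemma length_mult_Gamma: "length (u \<otimes>\<^bsub>Gamma\<^esub> v) \<le> length u + length v"
proof -
  have "length (push s w) \<le> Suc (length w)" for s w by (auto simp: push_def split: list.split)
  then have "length (foldr push u v) \<le> length u + length v"
    by (induction u) (auto intro: order_trans)
  then show ?thesis by (simp add: Gamma_def)
qed

section \<open>Balls inside induced subgraphs\<close>

abbreviation gball :: "'v colored_graph \<Rightarrow> 'v \<Rightarrow> nat \<Rightarrow> 'v set" where
  "gball G x r \<equiv> {y \<in> verts G. gdist G x y \<le> enat r}"

lemma coloring_induced_subgraph:
  "u \<in> W \<Longrightarrow> v \<in> W \<Longrightarrow> coloring (induced_subgraph G W) {u, v} = coloring G {u, v}"
  by (simp add: induced_subgraph_def)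

lemma gdist_step:
  assumes "gdist G x y \<le> enat r" "x = z \<or> (z, x) \<in> adj G"
  shows "gdist G z y \<le> enat (Suc r)"
proof -
  obtain n where n: "n \<le> r" "(x, y) \<in> adj G ^^ n" using assms(1) by (auto simp: gdist_le_iff)
  show ?thesis
  proof (cases "x = z")
    case True
    then show ?thesis using n by (auto simp: gdist_le_iff intro!: exI[of _ n])
  next
    case False
    then have "(z, y) \<in> adj G ^^ Suc n" using assms(2) n relpow_Suc_I2 by metis
    then show ?thesis using n(1) by (auto simp: gdist_le_iff simp del: relpow.simps
        intro!: exI[of _ "Suc n"])
  qed
qed

context four_colored_graph
begin

lemma adj_in: "(x, y) \<in> adj G \<Longrightarrow> x \<in> verts G \<and> y \<in> verts G"
  using edge[of "{x, y}"] by (auto simp: adj_def)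

text \<open>Every vertex of a path of length at most \<open>r\<close> from \<open>x\<close> is itself within distance \<open>r\<close> of \<open>x\<close>, so
  the paths that define the ball survive in any induced subgraph that contains the ball. The center
  \<open>x\<close> may differ from the vertex around which \<open>W\<close> was chosen, as is the case for a neighbour.\<close>

lemma rball_induced_subgraph:
  assumes sub: "gball G x r \<subseteq> W" "W \<subseteq> verts G" and x: "x \<in> verts G"
  shows "rball r (induced_subgraph G W, x) = rball r (G, x)"
proof -
  have *: "(x, y) \<in> adj (induced_subgraph G W) ^^ n \<longleftrightarrow> (x, y) \<in> adj G ^^ n" if "n \<le> r" for n y
    using that
  proof (induction n arbitrary: y)
    case (Suc n)
    have "(z, y) \<in> adj (induced_subgraph G W) \<longleftrightarrow> (z, y) \<in> adj G"
      if xz: "(x, z) \<in> adj G ^^ n" for z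
    proof
      assume zy: "(z, y) \<in> adj G"
      have "(x, y) \<in> adj G ^^ Suc n" using xz zy by auto
      then have "z \<in> gball G x r" "y \<in> gball G x r"
        using xz zy Suc.prems adj_in by (auto simp: gdist_le_iff simp del: relpow.simps
          intro: exI[of _ n] exI[of _ "Suc n"])
      then show "(z, y) \<in> adj (induced_subgraph G W)" using zy sub by (auto simp: adj_induced)
    qed (simp add: adj_induced)
    then show ?case using Suc by (auto simp: relcomp_unfold)
  qed simp
  have "{y \<in> W. gdist (induced_subgraph G W) x y \<le> enat r} = gball G x r"
    using * sub by (auto simp: gdist_le_iff)
  moreover have "induced_subgraph (induced_subgraph G W) (gball G x r) =
      induced_subgraph G (gball G x r)"
    using sub by (auto simp: induced_subgraph_def restrict_map_def fun_eq_iff)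
  moreover have "verts (induced_subgraph G W) = W" by (simp add: induced_subgraph_def)
  ultimately show ?thesis by (simp add: rball_def)
qed

section \<open>Types of neighbours\<close>

lemma rtype_eq_iff:
  assumes "x \<in> verts G" "y \<in> verts G"
  shows "rtype G r x = rtype G r y \<longleftrightarrow> rooted_iso (rball r (G, x)) (rball r (G, y))"
proof -
  have "rball r (G, x) \<in> rballs G r" "rball r (G, y) \<in> rballs G r"
    using assms by (auto simp: rballs_def)
  then show ?thesis
    using eq_equiv_class_iff[OF equiv_ball_equiv, of "rball r (G, x)" G r "rball r (G, y)"]
    by (simp add: rtype_def) (simp add: ball_equiv_def)
qed

text \<open>An isomorphism \<open>f\<close> between the \<open>(r + 1)\<close>-balls of \<open>x\<close> and \<open>y\<close> matches the images of the roots
  under \<open>s\<close>: either both roots have an \<open>s\<close>-edge, and properness of the coloring makes its other end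
  unique, or neither has one and \<open>s\<close> fixes both. Re-rooting \<open>f\<close> at these images and restricting it to
  the smaller balls around them gives the required isomorphism.\<close>

lemma rtype_gen_act:
  assumes x: "x \<in> verts G" and y: "y \<in> verts G"
    and eq: "rtype G (Suc r) x = rtype G (Suc r) y"
  shows "rtype G r (gen_act G s x) = rtype G r (gen_act G s y)"
proof -
  define V where "V = gball G x (Suc r)"
  define W where "W = gball G y (Suc r)"
  define H where "H = induced_subgraph G V"
  define K where "K = induced_subgraph G W"
  have verts: "verts H = V" "verts K = W" by (simp_all add: H_def K_def induced_subgraph_def)
  have adj: "adj H \<subseteq> verts H \<times> verts H" "adj K \<subseteq> verts K \<times> verts K"
    unfolding verts by (auto simp: H_def K_def adj_induced)
  have "rooted_iso (H, x) (K, y)"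
    using eq rtype_eq_iff[OF x y] by (simp add: rball_def H_def K_def V_def W_def)
  then obtain f where f: "bij_betw f V W" "f x = y"
    and col: "\<And>u v. u \<in> V \<Longrightarrow> v \<in> V \<Longrightarrow> coloring K {f u, f v} = coloring H {u, v}"
    by (auto simp: rooted_iso_def verts)
  have fW: "f u \<in> W" if "u \<in> V" for u using f(1) that by (rule bij_betwE[rule_format])
  \<comment> \<open>Vertices of the balls are joined in \<open>G\<close> as they are in the balls, since these are induced.\<close>
  have colG: "coloring G {f u, f v} = coloring G {u, v}" if "u \<in> V" "v \<in> V" for u v
    using col[OF that] that fW by (simp add: H_def K_def coloring_induced_subgraph)
  have near: "gball G v r \<subseteq> gball G u (Suc r)" "v \<in> gball G u (Suc r)"
    if "u \<in> verts G" "v = u \<or> (u, v) \<in> adj G" for u v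
  proof -
    show "gball G v r \<subseteq> gball G u (Suc r)" using gdist_step that(2) by fastforce
    have "gdist G v v \<le> enat r" by (auto simp: gdist_le_iff intro!: exI[of _ 0])
    then show "v \<in> gball G u (Suc r)" using gdist_step[of G v v r u] that adj_in by auto
  qed
  have step: "gen_act G s u = u \<or> (u, gen_act G s u) \<in> adj G" for u
  proof (cases "\<exists>z. coloring G {u, z} = Some s")
    case True
    then show ?thesis using gen_act_eq by (auto simp: adj_def)
  qed (simp add: gen_act_def)
  have inV: "x \<in> V" "gen_act G s x \<in> V" and inW: "gen_act G s y \<in> W"
    using near(2) step x y by (auto simp: V_def W_def)
  have fgen: "f (gen_act G s x) = gen_act G s y"
  proof (cases "\<exists>z. coloring G {x, z} = Some s")
    case True
    then have "coloring G {x, gen_act G s x} = Some s" using gen_act_eq by auto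
    then have "coloring G {y, f (gen_act G s x)} = Some s"
      using colG[OF inV] f(2) by simp
    then show ?thesis using gen_act_eq by simp
  next
    case False
    have "coloring G {y, z} \<noteq> Some s" for z
    proof
      assume z: "coloring G {y, z} = Some s"
      \<comment> \<open>An \<open>s\<close>-edge at \<open>y\<close> stays in its ball, as the radius is positive, so \<open>f\<close> pulls it back.\<close>
      then have "z \<in> W" using inW gen_act_eq by simp
      then obtain u where "u \<in> V" "z = f u" using f(1) by (auto simp: bij_betw_def)
      then have "coloring G {x, u} = Some s" using z colG[OF inV(1), of u] f(2) by simp
      then show False using False by blast
    qed
    then show ?thesis using False f(2) by (simp add: gen_act_def)
  qed
  have "rooted_iso (H, gen_act G s x) (K, gen_act G s y)"
    using f(1) fgen col by (auto simp: rooted_iso_def verts)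
  then have "rooted_iso (rball r (H, gen_act G s x)) (rball r (K, gen_act G s y))"
    using inV adj by (intro rooted_iso_rball) (simp_all add: verts)
  moreover have "rball r (H, gen_act G s x) = rball r (G, gen_act G s x)"
    unfolding H_def V_def
    using x step near(1) gen_act_in by (intro rball_induced_subgraph) auto
  moreover have "rball r (K, gen_act G s y) = rball r (G, gen_act G s y)"
    unfolding K_def W_def
    using y step near(1) gen_act_in by (intro rball_induced_subgraph) auto
  ultimately show ?thesis using rtype_eq_iff[OF gen_act_in[OF x] gen_act_in[OF y]] by simp
qed

lemma induced_action_in: "x \<in> verts G \<Longrightarrow> induced_action G w x \<in> verts G"
  using gen_act_in foldr_in[of "verts G" "gen_act G" x w] by (simp add: induced_action_def)

lemma rtype_induced_action:
  assumes "x \<in> verts G" "y \<in> verts G"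
    and "rtype G (r + length w) x = rtype G (r + length w) y"
  shows "rtype G r (induced_action G w x) = rtype G r (induced_action G w y)"
  using assms(3)
proof (induction w arbitrary: r)
  case Nil
  then show ?case using assms(1,2) by (simp add: induced_action_def)
next
  case (Cons s w)
  have "rtype G (Suc r) (induced_action G w x) = rtype G (Suc r) (induced_action G w y)"
    using Cons by simp
  then show ?case
    using rtype_gen_act induced_action_in assms(1,2) by (simp add: induced_action_def)
qed

section \<open>Chains as limits of vertices\<close>

text \<open>For \<open>N \<ge> 1\<close> and \<open>\<alpha>\<close> in the type space: the point \<open>\<pi>(x)\<close> is at distance less than \<open>2\<close> to the
  power \<open>-N\<close> from \<open>\<alpha>\<close>.\<close>

definition approximates :: "nat \<Rightarrow> 'v \<Rightarrow> (nat \<Rightarrow> 'v rooted set) \<Rightarrow> bool" where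
  "approximates N x \<alpha> \<longleftrightarrow> x \<in> verts G \<and> (\<forall>r\<in>{1..N}. \<alpha> r = rtype G r x)"

lemma approximates_mono: "approximates N x \<alpha> \<Longrightarrow> M \<le> N \<Longrightarrow> approximates M x \<alpha>"
  by (auto simp: approximates_def)

lemma approximates_type_map: "x \<in> verts G \<Longrightarrow> approximates N x (type_map G x)"
  by (simp add: approximates_def type_map_def)

text \<open>In a chain a class determines all earlier ones: the concentric smaller ball of a representative
  lies in the earlier class, and classes that share an element coincide.\<close>

lemma approximates_of_level:
  assumes \<alpha>: "\<alpha> \<in> type_space G" and x: "x \<in> verts G" and N: "\<alpha> N = rtype G N x"
  shows "approximates N x \<alpha>"
proof -
  have "\<alpha> r = rtype G r x" if "r \<le> N" "1 \<le> r" for r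
    using that
  proof (induction rule: inc_induct)
    case (step r)
    have "rball (Suc r) (G, x) \<in> rtype G (Suc r) x"
      using x by (auto simp: rtype_def ball_equiv_def rballs_def rooted_iso_refl)
    moreover have "type_prec r (\<alpha> r) (rtype G (Suc r) x)"
      using \<alpha> step by (auto simp: type_space_def)
    ultimately have "rball r (G, x) \<in> \<alpha> r"
      using rball_rball[OF x, of r "Suc r"] by (fastforce simp: type_prec_def)
    moreover have "\<alpha> r \<in> rtypes G r" using \<alpha> step by (auto simp: type_space_def)
    ultimately show ?case
      using equiv_ball_equiv[of G r] unfolding rtypes_def rtype_def
      by (metis Image_singleton_iff equiv_class_eq quotientE)
  qed (rule N)
  then show ?thesis using x by (simp add: approximates_def)
qed

text \<open>The image of \<open>\<pi>\<close> is dense in the type space.\<close>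

lemma ex_approximates:
  assumes "\<alpha> \<in> type_space G"
  shows "\<exists>x. approximates N x \<alpha>"
proof -
  \<comment> \<open>The level \<open>N + 1\<close> is at least one even for \<open>N = 0\<close>, where chains carry no type.\<close>
  have "\<alpha> (Suc N) \<in> rtypes G (Suc N)" using assms by (auto simp: type_space_def)
  then obtain x where "x \<in> verts G" "\<alpha> (Suc N) = rtype G (Suc N) x"
    by (auto simp: rtypes_def rtype_def rballs_def elim!: quotientE)
  then have "approximates (Suc N) x \<alpha>" using approximates_of_level assms by blast
  then show ?thesis using approximates_mono[of "Suc N" x \<alpha> N] by auto
qed

section \<open>The extended action\<close>

text \<open>The class of radius \<open>r\<close> of the image is read off from a vertex that approximates the chain up to
  radius \<open>r + length w\<close>; the next lemma shows that its choice does not matter.\<close>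

definition type_action :: "color list \<Rightarrow> (nat \<Rightarrow> 'v rooted set) \<Rightarrow> nat \<Rightarrow> 'v rooted set" where
  "type_action w = (\<lambda>\<alpha>\<in>type_space G. \<lambda>r\<in>{1..}.
    rtype G r (induced_action G w (SOME x. approximates (r + length w) x \<alpha>)))"

lemma type_action_approximates:
  assumes \<alpha>: "\<alpha> \<in> type_space G" and x: "approximates (N + length w) x \<alpha>"
  shows "approximates N (induced_action G w x) (type_action w \<alpha>)"
  unfolding approximates_def
proof (intro conjI ballI)
  show "induced_action G w x \<in> verts G"
    using x induced_action_in by (simp add: approximates_def)
next
  fix r assume r: "r \<in> {1..N}"
  define y where "y = (SOME y. approximates (r + length w) y \<alpha>)"
  have "approximates (r + length w) y \<alpha>"
    unfolding y_def using ex_approximates[OF \<alpha>] by (rule someI_ex)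
  then have "y \<in> verts G" "x \<in> verts G" "rtype G (r + length w) y = rtype G (r + length w) x"
    using x r by (auto simp: approximates_def)
  then have "rtype G r (induced_action G w y) = rtype G r (induced_action G w x)"
    by (rule rtype_induced_action)
  then show "type_action w \<alpha> r = rtype G r (induced_action G w x)"
    using \<alpha> r by (simp add: type_action_def y_def)
qed

text \<open>Compatibility of consecutive classes involves only two radii, and up to the larger one the image
  agrees with \<open>\<pi>(y)\<close> for some vertex \<open>y\<close>.\<close>

lemma type_action_in:
  assumes \<alpha>: "\<alpha> \<in> type_space G"
  shows "type_action w \<alpha> \<in> type_space G"
proof -
  have "type_action w \<alpha> r \<in> rtypes G r \<and> type_prec r (type_action w \<alpha> r) (type_action w \<alpha> (Suc r))"
    if r: "1 \<le> r" for r
  proof -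
    obtain x where "approximates (Suc r + length w) x \<alpha>" using ex_approximates[OF \<alpha>] by blast
    then have y: "approximates (Suc r) (induced_action G w x) (type_action w \<alpha>)"
      by (rule type_action_approximates[OF \<alpha>])
    then have "type_map G (induced_action G w x) \<in> type_space G"
      by (intro type_map_in_type_space) (simp add: approximates_def)
    moreover have "type_action w \<alpha> q = type_map G (induced_action G w x) q"
      if "q \<in> {r, Suc r}" for q
      using y r that by (auto simp: approximates_def type_map_def)
    ultimately show ?thesis using r by (auto simp: type_space_def)
  qed
  moreover have "type_action w \<alpha> \<in> extensional {1..}" using \<alpha> by (simp add: type_action_def)
  ultimately show ?thesis by (auto simp: type_space_def PiE_def)
qed

text \<open>Identities between chains reduce to identities between vertices that approximate both sides.\<close>

lemma type_space_eqI:
  assumes "\<alpha> \<in> type_space G" "\<beta> \<in> type_space G"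
    and "\<And>N. \<exists>x. approximates N x \<alpha> \<and> approximates N x \<beta>"
  shows "\<alpha> = \<beta>"
proof (rule PiE_ext)
  show "\<alpha> \<in> PiE {1..} (rtypes G)" "\<beta> \<in> PiE {1..} (rtypes G)"
    using assms(1,2) by (simp_all add: type_space_def)
  show "\<alpha> r = \<beta> r" if "r \<in> {1..}" for r
    using assms(3)[of r] that by (auto simp: approximates_def)
qed

lemma type_action_type_map:
  assumes "x \<in> verts G"
  shows "type_action w (type_map G x) = type_map G (induced_action G w x)"
  using assms type_map_in_type_space induced_action_in approximates_type_map
  by (intro type_space_eqI type_action_in exI[of _ "induced_action G w x"] conjI
      type_action_approximates) auto

lemma type_action_one:
  assumes "\<alpha> \<in> type_space G"
  shows "type_action \<one>\<^bsub>Gamma\<^esub> \<alpha> = \<alpha>"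
proof (intro type_space_eqI type_action_in assms)
  fix N
  obtain x where x: "approximates N x \<alpha>" using ex_approximates[OF assms] by blast
  then have "induced_action G \<one>\<^bsub>Gamma\<^esub> x = x"
    by (simp add: approximates_def induced_action_def Gamma_def)
  then show "\<exists>x. approximates N x (type_action \<one>\<^bsub>Gamma\<^esub> \<alpha>) \<and> approximates N x \<alpha>"
    using x type_action_approximates[OF assms, of N "\<one>\<^bsub>Gamma\<^esub>" x]
    by (auto simp: Gamma_def)
qed

text \<open>A vertex that approximates \<open>\<alpha>\<close> up to \<open>N + length u + length v\<close> serves both sides: applying \<open>v\<close> and
  then \<open>u\<close> uses up the two lengths, and the product word is no longer than their sum.\<close>

lemma type_action_mult:
  assumes \<alpha>: "\<alpha> \<in> type_space G"
  shows "type_action (u \<otimes>\<^bsub>Gamma\<^esub> v) \<alpha> = type_action u (type_action v \<alpha>)"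
proof (intro type_space_eqI type_action_in \<alpha>)
  fix N
  obtain x where x: "approximates (N + length u + length v) x \<alpha>"
    using ex_approximates[OF \<alpha>] by blast
  have "approximates (N + length (u \<otimes>\<^bsub>Gamma\<^esub> v)) x \<alpha>"
    using approximates_mono[OF x] length_mult_Gamma[of u v] by simp
  then have "approximates N (induced_action G (u \<otimes>\<^bsub>Gamma\<^esub> v) x) (type_action (u \<otimes>\<^bsub>Gamma\<^esub> v) \<alpha>)"
    by (rule type_action_approximates[OF \<alpha>])
  moreover have "approximates N (induced_action G u (induced_action G v x))
      (type_action u (type_action v \<alpha>))"
    using x \<alpha> by (intro type_action_approximates type_action_in)
  ultimately show "\<exists>x. approximates N x (type_action (u \<otimes>\<^bsub>Gamma\<^esub> v) \<alpha>) \<and>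
      approximates N x (type_action u (type_action v \<alpha>))"
    using induced_action_mult x by (auto simp: approximates_def)
qed

lemma type_action_cong:
  assumes "\<alpha> \<in> type_space G" "\<beta> \<in> type_space G" "1 \<le> r"
    and "\<alpha> (r + length w) = \<beta> (r + length w)"
  shows "type_action w \<alpha> r = type_action w \<beta> r"
proof -
  obtain x where x: "approximates (r + length w) x \<alpha>" using ex_approximates[OF assms(1)] by blast
  then have "approximates (r + length w) x \<beta>"
    using approximates_of_level[OF assms(2), of x "r + length w"] assms(3,4)
    by (simp add: approximates_def)
  then have "approximates r (induced_action G w x) (type_action w \<alpha>)"
    "approximates r (induced_action G w x) (type_action w \<beta>)"
    using x assms by (auto intro: type_action_approximates)
  then show ?thesis using assms(3) by (simp add: approximates_def)
qed

text \<open>If the images first differ at radius \<open>r\<close>, then the chains themselves already differ at radius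
  \<open>r + length w\<close>.\<close>

lemma type_action_Lipschitz:
  assumes \<alpha>: "\<alpha> \<in> type_space G" and \<beta>: "\<beta> \<in> type_space G"
  shows "type_dist (type_action w \<alpha>) (type_action w \<beta>) \<le> 2 ^ length w * type_dist \<alpha> \<beta>"
proof (cases "type_action w \<alpha> = type_action w \<beta>")
  case False
  let ?P = "\<lambda>r. 1 \<le> r \<and> type_action w \<alpha> r \<noteq> type_action w \<beta> r"
  define r where "r = (LEAST r. ?P r)"
  have "\<exists>r. ?P r"
    using False PiE_ext[of "type_action w \<alpha>" "{1..}" "rtypes G" "type_action w \<beta>"]
      type_action_in[OF \<alpha>] type_action_in[OF \<beta>]
    by (auto simp: type_space_def)
  then have r: "1 \<le> r" "type_action w \<alpha> r \<noteq> type_action w \<beta> r"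
    unfolding r_def by (metis (mono_tags, lifting) LeastI)+
  then have ne: "\<alpha> (r + length w) \<noteq> \<beta> (r + length w)" using type_action_cong[OF \<alpha> \<beta>] by blast
  then have "(LEAST k. 1 \<le> k \<and> \<alpha> k \<noteq> \<beta> k) \<le> r + length w" using r by (intro Least_le) auto
  then have "(1 / 2) ^ (r + length w) \<le> type_dist \<alpha> \<beta>"
    using ne by (auto simp: type_dist_def intro!: power_decreasing)
  then have "2 ^ length w * (1 / 2) ^ (r + length w) \<le> 2 ^ length w * type_dist \<alpha> \<beta>"
    by (rule mult_left_mono) simp
  moreover have "(2::real) ^ length w * (1 / 2) ^ (r + length w) = (1 / 2) ^ r"
    by (simp add: power_add power_one_over)
  moreover have "type_dist (type_action w \<alpha>) (type_action w \<beta>) = (1 / 2) ^ r"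
    using False by (simp add: type_dist_def r_def)
  ultimately show ?thesis by linarith
qed (simp add: type_dist_def)

lemma continuous_map_type_action:
  "continuous_map (type_topology G) (type_topology G) (type_action w)"
proof -
  interpret Metric_space "type_space G" type_dist by (rule Metric_space_type_space)
  have "Lipschitz_continuous_map (metric (type_space G, type_dist)) (metric (type_space G, type_dist))
      (type_action w)"
    unfolding Lipschitz_continuous_map_def
    using type_action_in type_action_Lipschitz
    by (auto intro!: exI[of _ "2 ^ length w"])
  then show ?thesis
    using Lipschitz_continuous_imp_continuous_map by (fastforce simp: type_topology_def)
qed

lemma homeomorphic_map_type_action:
  assumes "w \<in> carrier Gamma"
  shows "homeomorphic_map (type_topology G) (type_topology G) (type_action w)"
proof -
  interpret Metric_space "type_space G" type_dist by (rule Metric_space_type_space)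
  have "homeomorphic_maps (type_topology G) (type_topology G) (type_action w)
      (type_action (inv\<^bsub>Gamma\<^esub> w))"
    unfolding homeomorphic_maps_def
    using continuous_map_type_action type_action_one assms
    by (simp add: type_topology_def group.l_inv group.r_inv group_Gamma flip: type_action_mult)
  then show ?thesis by (rule homeomorphic_maps_map[THEN iffD1, THEN conjunct1])
qed

end

theorem proposition2p1:
  fixes G :: "'v colored_graph"
  assumes "four_colored_graph G"
  shows "\<exists>\<Psi>. group_action Gamma (type_space G) \<Psi> \<and>
    (\<forall>\<gamma>\<in>carrier Gamma. homeomorphic_map (type_topology G) (type_topology G) (\<Psi> \<gamma>)) \<and>
    (\<forall>\<gamma>\<in>carrier Gamma. \<forall>x\<in>verts G. \<Psi> \<gamma> (type_map G x) = type_map G (induced_action G \<gamma> x))"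
proof -
  interpret four_colored_graph G by fact
  have "group_action Gamma (type_space G) type_action"
    by (intro group_actionI group_Gamma type_action_in type_action_one type_action_mult)
      (simp_all add: type_action_def)
  then show ?thesis
    using homeomorphic_map_type_action type_action_type_map by blast
qed

end
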